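(* Let $\mathcal{H}$ be a separable complex Hilbert space, let $C$ be a conjugation on $\mathcal{H}$, and let $T \in B(\mathcal{H})$ be a $C$-symmetric partial isometry. Then there exist a $C$-symmetric unitary operator $U \in B(\mathcal{H})$ and an orthogonal projection $P \in B(\mathcal{H})$ such that $T = UP$.
   Context: $B(\mathcal{H})$ denotes the bounded linear operators on $\mathcal{H}$. A conjugation on a complex Hilbert space $\mathcal{H}$ is a conjugate-linear operator $C:\mathcal{H}\to\mathcal{H}$ which is involutive ($C^2 = I$) and isometric ($\langle Cx, Cy\rangle = \langle y, x\rangle$ for all $x,y \in \mathcal{H}$). An operator $T \in B(\mathcal{H})$ is $C$-symmetric if $T = CT^*C$. The same conjugation $C$ is used for $T$ and for $U$. *)

theory Defs
  imports "HOL-Analysis.Analysis"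
begin

class complex_vector = real_vector +
  fixes scaleC :: "complex \<Rightarrow> 'a \<Rightarrow> 'a"  (infixr "*\<^sub>C" 75)
  assumes scaleC_add_right: "c *\<^sub>C (x + y) = c *\<^sub>C x + c *\<^sub>C y"
    and scaleC_add_left: "(c + d) *\<^sub>C x = c *\<^sub>C x + d *\<^sub>C x"
    and scaleC_scaleC: "c *\<^sub>C d *\<^sub>C x = (c * d) *\<^sub>C x"
    and scaleC_one: "1 *\<^sub>C x = x"
    and scaleR_scaleC: "r *\<^sub>R x = complex_of_real r *\<^sub>C x"

text \<open>
  The complex inner product is linear in its first argument. The norm and the metric are
  inherited from \<^class>\<open>real_inner\<close>, whose inner product is required to be the real part of the
  complex one; so the norm of \<open>x\<close> is the square root of \<open>cinner x x\<close>, and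
  positive definiteness comes from \<^class>\<open>real_inner\<close>.
\<close>

class complex_inner = complex_vector + real_inner +
  fixes cinner :: "'a \<Rightarrow> 'a \<Rightarrow> complex"
  assumes cinner_commute: "cinner x y = cnj (cinner y x)"
    and cinner_add_left: "cinner (x + y) z = cinner x z + cinner y z"
    and cinner_scaleC_left: "cinner (c *\<^sub>C x) y = c * cinner x y"
    and inner_eq_Re_cinner: "x \<bullet> y = Re (cinner x y)"

class complex_hilbert = complex_inner + complete_space

instantiation complex :: complex_hilbert
begin

definition scaleC_complex :: "complex \<Rightarrow> complex \<Rightarrow> complex"
  where "scaleC_complex = (*)"

definition cinner_complex :: "complex \<Rightarrow> complex \<Rightarrow> complex"
  where "cinner_complex x y = x * cnj y"

instance
  by standard
    (auto simp: scaleC_complex_def cinner_complex_def inner_complex_def scaleR_conv_of_real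
      algebra_simps)

end

lemma cinner_self: "cinner x x = complex_of_real ((norm x)\<^sup>2)"
proof (rule complex_eqI)
  show "Im (cinner x x) = Im (complex_of_real ((norm x)\<^sup>2))"
    using arg_cong[OF cinner_commute[of x x], of Im] by simp
qed (simp add: power2_norm_eq_inner inner_eq_Re_cinner)

definition bounded_clinear :: "('a::complex_inner \<Rightarrow> 'b::complex_inner) \<Rightarrow> bool"
  where "bounded_clinear T \<longleftrightarrow> bounded_linear T \<and> (\<forall>c x. T (c *\<^sub>C x) = c *\<^sub>C T x)"

definition cadjoint :: "('a::complex_inner \<Rightarrow> 'b::complex_inner) \<Rightarrow> 'b \<Rightarrow> 'a"
  where "cadjoint T = (SOME S. \<forall>x y. cinner (T x) y = cinner x (S y))"

definition conjugation :: "('a::complex_inner \<Rightarrow> 'a) \<Rightarrow> bool"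
  where "conjugation C \<longleftrightarrow>
    (\<forall>x y. C (x + y) = C x + C y) \<and> (\<forall>c x. C (c *\<^sub>C x) = cnj c *\<^sub>C C x) \<and>
    C \<circ> C = id \<and> (\<forall>x y. cinner (C x) (C y) = cinner y x)"

definition C_symmetric :: "('a::complex_inner \<Rightarrow> 'a) \<Rightarrow> ('a \<Rightarrow> 'a) \<Rightarrow> bool"
  where "C_symmetric C T \<longleftrightarrow> T = C \<circ> cadjoint T \<circ> C"

definition orth_complement :: "'a::complex_inner set \<Rightarrow> 'a set"
  where "orth_complement S = {x. \<forall>y\<in>S. cinner x y = 0}"

definition partial_isometry :: "('a::complex_inner \<Rightarrow> 'b::complex_inner) \<Rightarrow> bool"
  where "partial_isometry T \<longleftrightarrow>
    bounded_clinear T \<and> (\<forall>x\<in>orth_complement {y. T y = 0}. norm (T x) = norm x)"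

definition unitary_op :: "('a::complex_inner \<Rightarrow> 'a) \<Rightarrow> bool"
  where "unitary_op U \<longleftrightarrow>
    bounded_clinear U \<and> cadjoint U \<circ> U = id \<and> U \<circ> cadjoint U = id"

definition orthogonal_projection :: "('a::complex_inner \<Rightarrow> 'a) \<Rightarrow> bool"
  where "orthogonal_projection P \<longleftrightarrow>
    bounded_clinear P \<and> P \<circ> P = P \<and> cadjoint P = P"

text \<open>
  \<^const>\<open>cadjoint\<close> is the Hilbert space adjoint: by the Riesz representation theorem a map with
  the defining property exists for every bounded operator, and it is unique.
\<close>

lemma riesz_real:
  fixes f :: "'a::{real_inner, complete_space} \<Rightarrow> real"
  assumes "bounded_linear f"
  shows "\<exists>z. \<forall>x. f x = x \<bullet> z"
proof -
  interpret f: bounded_linear f by fact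
  obtain K where K: "\<And>x. \<bar>f x\<bar> \<le> norm x * K"
    using f.bounded by auto
  define J where "J x = x \<bullet> x - 2 * f x" for x
  have J_ge: "- (K * K) \<le> J x" for x
  proof -
    have "0 \<le> (norm x - K) * (norm x - K)" by simp
    moreover have "f x \<le> norm x * K" using K[of x] by linarith
    moreover have "x \<bullet> x = norm x * norm x" by (simp add: norm_eq_sqrt_inner)
    ultimately show ?thesis by (simp add: J_def algebra_simps)
  qed
  define m where "m = (INF x. J x)"
  have bdd: "bdd_below (range J)" using J_ge by (auto intro!: bdd_belowI)
  have m_le: "m \<le> J x" for x unfolding m_def by (rule cINF_lower[OF bdd]) simp
  have "\<exists>x. J x < m + inverse (Suc n)" for n
    using cINF_less_iff[OF _ bdd, of "m + inverse (Suc n)"] by (auto simp: m_def[symmetric])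
  then obtain X where X: "\<And>n. J (X n) < m + inverse (Suc n)" by metis
  have par: "(norm (x - y))\<^sup>2 \<le> 2 * (J x - m) + 2 * (J y - m)" for x y
  proof -
    have "J x + J y = 2 * J ((1/2) *\<^sub>R (x + y)) + (x - y) \<bullet> (x - y) / 2"
      by (simp add: J_def f.add f.scaleR inner_simps inner_commute field_simps)
    with m_le[of "(1/2) *\<^sub>R (x + y)"] show ?thesis by (simp add: power2_norm_eq_inner)
  qed
  have "Cauchy X"
  proof (rule metric_CauchyI)
    fix e :: real assume "0 < e"
    then obtain N where N: "inverse (real (Suc N)) < e\<^sup>2 / 4"
      using reals_Archimedean[of "e\<^sup>2 / 4"] by auto
    have small: "J (X n) - m < e\<^sup>2 / 4" if "n \<ge> N" for n
    proof -
      have "inverse (real (Suc n)) \<le> inverse (real (Suc N))" using that by (simp add: field_simps)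
      with X[of n] N show ?thesis by linarith
    qed
    have "dist (X i) (X j) < e" if "i \<ge> N" "j \<ge> N" for i j
    proof -
      have "(norm (X i - X j))\<^sup>2 < e\<^sup>2"
        using par[of "X i" "X j"] small[OF that(1)] small[OF that(2)] by (simp add: field_simps)
      then show ?thesis using \<open>0 < e\<close> using power2_less_imp_less[of "norm (X i - X j)" e] by (simp add: dist_norm)
    qed
    then show "\<exists>M. \<forall>i\<ge>M. \<forall>j\<ge>M. dist (X i) (X j) < e" by blast
  qed
  then obtain z where z: "X \<longlonglongrightarrow> z"
    using Cauchy_convergent convergent_def by blast
  have "(\<lambda>n. J (X n)) \<longlonglongrightarrow> J z"
    unfolding J_def by (intro tendsto_intros f.tendsto z)
  moreover have "(\<lambda>n. m + inverse (real (Suc n))) \<longlonglongrightarrow> m + 0"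
    by (intro tendsto_intros LIMSEQ_inverse_real_of_nat)
  ultimately have "J z \<le> m"
    using LIMSEQ_le[of "\<lambda>n. J (X n)" "J z" "\<lambda>n. m + inverse (real (Suc n))" "m + 0"] X
    by (auto intro: less_imp_le)
  have "f h = h \<bullet> z" for h
  proof (rule ccontr)
    assume ne: "f h \<noteq> h \<bullet> z"
    define d where "d = h \<bullet> z - f h"
    have "h \<noteq> 0" using ne by (auto simp: f.zero)
    then have pos: "0 < h \<bullet> h" by simp
    define t where "t = - d / (h \<bullet> h)"
    have th: "t * (h \<bullet> h) = - d" using pos by (simp add: t_def)
    have "J (z + t *\<^sub>R h) = J z + 2 * t * d + t * (t * (h \<bullet> h))"
      by (simp add: J_def d_def f.add f.scaleR inner_simps inner_commute algebra_simps)
    also have "\<dots> = J z + t * d" by (simp add: th)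
    also have "\<dots> = J z - d\<^sup>2 / (h \<bullet> h)" by (simp add: t_def power2_eq_square)
    also have "\<dots> < J z" using ne pos by (simp add: d_def)
    finally show False using m_le[of "z + t *\<^sub>R h"] \<open>J z \<le> m\<close> by linarith
  qed
  then show ?thesis by blast
qed

lemma cinner_cadjoint:
  fixes T :: "'a::complex_hilbert \<Rightarrow> 'b::complex_inner"
  assumes "bounded_clinear T"
  shows "cinner (T x) y = cinner x (cadjoint T y)"
proof -
  have lin: "bounded_linear T" and hom: "\<And>c x. T (c *\<^sub>C x) = c *\<^sub>C T x"
    using assms by (auto simp: bounded_clinear_def)
  have "\<exists>z. \<forall>x. cinner (T x) y = cinner x z" for y
  proof -
    have "bounded_linear (\<lambda>x. T x \<bullet> y)"
      by (rule bounded_linear_compose[OF bounded_linear_inner_left lin])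
    then obtain z where z: "\<And>x. T x \<bullet> y = x \<bullet> z" using riesz_real by blast
    have "cinner (T x) y = cinner x z" for x
      using z[of x] z[of "\<i> *\<^sub>C x"]
      by (intro complex_eqI) (simp_all add: inner_eq_Re_cinner hom cinner_scaleC_left)
    then show ?thesis by blast
  qed
  then have "\<exists>S. \<forall>x y. cinner (T x) y = cinner x (S y)" by metis
  from someI_ex[OF this] show ?thesis unfolding cadjoint_def by blast
qed

lemma cadjoint_unique:
  assumes "\<And>x y. cinner (T x) y = cinner x (S y)"
  shows "cadjoint T = S"
proof -
  have "\<forall>x y. cinner (T x) y = cinner x (cadjoint T y)"
    unfolding cadjoint_def by (rule someI[of _ S]) (simp add: assms)
  then have "x \<bullet> cadjoint T y = x \<bullet> S y" for x y
    by (simp add: inner_eq_Re_cinner assms)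
  then show ?thesis by (auto simp: fun_eq_iff intro: vector_eq_ldot[THEN iffD1])
qed

end

theory Submission
  imports Defs
begin

text \<open>
  Write \<open>P = T\<^sup>* T\<close>. For a partial isometry this is an orthogonal projection with \<open>T P = T\<close>. The
  \<open>C\<close>-symmetry of \<open>T\<close> reads \<open>T\<^sup>* = C T C\<close>, so the conjugate-linear map \<open>C T\<close> has square \<open>P\<close>: it is
  a conjugation of the range of \<open>P\<close>. If \<open>J\<close> is a conjugation of the whole space that agrees with
  \<open>C T\<close> on the range of \<open>P\<close>, then \<open>U = C J\<close> is unitary with \<open>U\<^sup>* = J C\<close>, hence \<open>C\<close>-symmetric, and
  \<open>U P = C J P = C C T P = T\<close>.

  The work is in extending \<open>C T\<close> to \<open>J\<close>. A conjugation is determined by its real subspace of fixed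
  vectors, on which the complex inner product takes real values. Conversely, a maximal set with
  pairwise real inner products is a Lagrangian subspace for the symplectic form \<open>Im (cinner x y)\<close>:
  a closed real subspace \<open>R\<close> whose real orthogonal complement is \<open>\<i> R\<close>. So every vector is uniquely
  \<open>x + \<i> y\<close> with \<open>x\<close> and \<open>y\<close> in \<open>R\<close>, and \<open>x + \<i> y \<mapsto> x - \<i> y\<close> is a conjugation that fixes
  \<open>R\<close>. By Zorn's lemma, every set with pairwise real inner products is therefore fixed by some
  conjugation (\<open>totally_real_fixed_by_conjugation\<close>). This is applied to the fixed vectors of
  \<open>C T\<close>, whose complex span is the range of \<open>P\<close>.
\<close>

section \<open>Complex inner products\<close>

lemma cinner_add_right: "cinner x (y + z) = cinner x y + cinner x (z :: 'a::complex_inner)"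
proof -
  have "cinner x (y + z) = cnj (cinner (y + z) x)" by (rule cinner_commute)
  also have "\<dots> = cnj (cinner y x) + cnj (cinner z x)" by (simp add: cinner_add_left)
  finally show ?thesis by (simp only: cinner_commute[symmetric])
qed

lemma cinner_scaleC_right: "cinner x (c *\<^sub>C y) = cnj c * cinner x (y :: 'a::complex_inner)"
proof -
  have "cinner x (c *\<^sub>C y) = cnj (cinner (c *\<^sub>C y) x)" by (rule cinner_commute)
  also have "\<dots> = cnj c * cnj (cinner y x)" by (simp add: cinner_scaleC_left)
  finally show ?thesis by (simp only: cinner_commute[symmetric])
qed

lemma scaleC_minus1: "(-1) *\<^sub>C x = - (x :: 'a::complex_vector)"
  using scaleR_scaleC[of "-1" x] by simp

lemma scaleC_minus_left: "(- c) *\<^sub>C x = - (c *\<^sub>C (x :: 'a::complex_vector))"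
  using scaleC_scaleC[of "-1" c x] by (simp add: scaleC_minus1)

lemma scaleC_minus_right: "c *\<^sub>C (- x) = - (c *\<^sub>C (x :: 'a::complex_vector))"
  using scaleC_scaleC[of c "-1" x] by (simp add: scaleC_minus_left scaleC_one)

lemma scaleC_diff_right: "c *\<^sub>C (x - y) = c *\<^sub>C x - c *\<^sub>C (y :: 'a::complex_vector)"
  using scaleC_add_right[of c x "- y"] by (simp add: scaleC_minus_right)

lemma scaleC_conv_scaleR: "c *\<^sub>C x = Re c *\<^sub>R x + Im c *\<^sub>R (\<i> *\<^sub>C (x :: 'a::complex_vector))"
proof -
  have "c = of_real (Re c) + of_real (Im c) * \<i>" by (simp add: complex_eq_iff)
  then have "c *\<^sub>C x = (of_real (Re c) + of_real (Im c) * \<i>) *\<^sub>C x" by (rule arg_cong)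
  then show ?thesis by (simp only: scaleC_add_left scaleR_scaleC scaleC_scaleC)
qed

lemma scaleC_ii_ii: "\<i> *\<^sub>C \<i> *\<^sub>C x = - (x :: 'a::complex_vector)"
  by (simp add: scaleC_scaleC scaleC_minus1)

lemma cinner_minus_left: "cinner (- x) y = - cinner x (y :: 'a::complex_inner)"
  using cinner_scaleC_left[of "-1" x y] by (simp add: scaleC_minus1)

lemma cinner_minus_right: "cinner x (- y) = - cinner x (y :: 'a::complex_inner)"
  using cinner_scaleC_right[of x "-1" y] by (simp add: scaleC_minus1)

lemma cinner_diff_left: "cinner (x - y) z = cinner x z - cinner y (z :: 'a::complex_inner)"
  using cinner_add_left[of x "- y" z] by (simp add: cinner_minus_left)

lemma cinner_diff_right: "cinner x (y - z) = cinner x y - cinner x (z :: 'a::complex_inner)"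
  using cinner_add_right[of x y "- z"] by (simp add: cinner_minus_right)

lemmas cinner_simps = cinner_add_left cinner_add_right cinner_diff_left cinner_diff_right
  cinner_minus_left cinner_minus_right cinner_scaleC_left cinner_scaleC_right

lemma inner_scaleC_ii_right: "x \<bullet> (\<i> *\<^sub>C y) = Im (cinner x (y :: 'a::complex_inner))"
  by (simp add: inner_eq_Re_cinner cinner_scaleC_right)

lemma Im_cinner_commute: "Im (cinner x y) = - Im (cinner y (x :: 'a::complex_inner))"
  using arg_cong[OF cinner_commute[of x y], of Im] by simp

lemma cinner_eq_zero_iff: "cinner x x = 0 \<longleftrightarrow> x = (0 :: 'a::complex_inner)"
  by (simp add: cinner_self)

text \<open>Polarization: norms of sums determine the real inner product, and the real inner products with
  \<open>y\<close> and with \<open>\<i> y\<close> are the real and imaginary parts of the complex one.\<close>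

lemma clinear_isometry_cinner:
  fixes T :: "'a::complex_inner \<Rightarrow> 'b::complex_inner"
  assumes T: "bounded_clinear T"
    and M_add: "\<And>x y. x \<in> M \<Longrightarrow> y \<in> M \<Longrightarrow> x + y \<in> M"
    and M_scale: "\<And>c x. x \<in> M \<Longrightarrow> c *\<^sub>C x \<in> M"
    and iso: "\<And>x. x \<in> M \<Longrightarrow> norm (T x) = norm x"
    and x: "x \<in> M" and y: "y \<in> M"
  shows "cinner (T x) (T y) = cinner x y"
proof -
  have add: "T (u + v) = T u + T v" and hom: "T (c *\<^sub>C u) = c *\<^sub>C T u" for u v c
    using T by (auto simp: bounded_clinear_def linear_simps)
  have re: "T x \<bullet> T z = x \<bullet> z" if "z \<in> M" for z
  proof -
    have "T x \<bullet> T z = ((norm (T (x + z)))\<^sup>2 - (norm (T x))\<^sup>2 - (norm (T z))\<^sup>2) / 2"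
      by (simp add: add power2_norm_eq_inner inner_simps inner_commute)
    also have "\<dots> = x \<bullet> z"
      using iso[OF M_add[OF x that]] iso[OF x] iso[OF that]
      by (simp add: power2_norm_eq_inner inner_simps inner_commute)
    finally show ?thesis .
  qed
  show ?thesis
    using re[OF y] re[OF M_scale[OF y, of \<i>]]
    by (intro complex_eqI) (simp_all add: hom inner_scaleC_ii_right inner_eq_Re_cinner[symmetric])
qed

section \<open>Orthogonal projection onto a closed subspace\<close>

text \<open>The projection is the nearest point. By the parallelogram law a minimizing sequence is a
  Cauchy sequence, and moving from its limit along \<open>y\<close> cannot decrease the distance, which forces
  orthogonality to \<open>y\<close>.\<close>

lemma closed_subspace_nearest_point:
  fixes R :: "'a::{real_inner, complete_space} set"
  assumes sub: "subspace R" and "closed R"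
  shows "\<exists>x\<in>R. \<forall>y\<in>R. (z - x) \<bullet> y = 0"
proof -
  define D where "D x = (norm (z - x))\<^sup>2" for x
  define m where "m = (INF x\<in>R. D x)"
  have "R \<noteq> {}" using subspace_0[OF sub] by auto
  have bdd: "bdd_below (D ` R)" by (auto simp: D_def intro!: bdd_belowI[of _ 0])
  have m_le: "m \<le> D x" if "x \<in> R" for x
    unfolding m_def using bdd that by (rule cINF_lower)
  have "\<exists>x\<in>R. D x < m + inverse (Suc n)" for n
    using cINF_less_iff[OF \<open>R \<noteq> {}\<close> bdd, of "m + inverse (Suc n)"] by (auto simp: m_def[symmetric])
  then obtain X where XR: "\<And>n. X n \<in> R" and X: "\<And>n. D (X n) < m + inverse (Suc n)" by metis
  have par: "(norm (x - y))\<^sup>2 \<le> 2 * (D x - m) + 2 * (D y - m)" if "x \<in> R" "y \<in> R" for x y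
  proof -
    have "D x + D y = 2 * D ((1/2) *\<^sub>R (x + y)) + (norm (x - y))\<^sup>2 / 2"
      by (simp add: D_def power2_norm_eq_inner inner_simps inner_commute field_simps)
    moreover have "(1/2) *\<^sub>R (x + y) \<in> R"
      by (intro subspace_scale[OF sub] subspace_add[OF sub] that)
    ultimately show ?thesis using m_le[of "(1/2) *\<^sub>R (x + y)"] by simp
  qed
  have "Cauchy X"
  proof (rule metric_CauchyI)
    fix e :: real assume "0 < e"
    then obtain N where N: "inverse (real (Suc N)) < e\<^sup>2 / 4"
      using reals_Archimedean[of "e\<^sup>2 / 4"] by auto
    have small: "D (X n) - m < e\<^sup>2 / 4" if "n \<ge> N" for n
    proof -
      have "inverse (real (Suc n)) \<le> inverse (real (Suc N))" using that by (simp add: field_simps)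
      with X[of n] N show ?thesis by linarith
    qed
    have "dist (X i) (X j) < e" if "i \<ge> N" "j \<ge> N" for i j
    proof -
      have "(norm (X i - X j))\<^sup>2 < e\<^sup>2"
        using par[OF XR[of i] XR[of j]] small[OF that(1)] small[OF that(2)]
        by (simp add: field_simps)
      then show ?thesis
        using \<open>0 < e\<close> power2_less_imp_less[of "norm (X i - X j)" e] by (simp add: dist_norm)
    qed
    then show "\<exists>M. \<forall>i\<ge>M. \<forall>j\<ge>M. dist (X i) (X j) < e" by blast
  qed
  then obtain x where x: "X \<longlonglongrightarrow> x"
    using Cauchy_convergent convergent_def by blast
  have "x \<in> R" using closed_sequentially[OF \<open>closed R\<close>] XR x by blast
  have "(\<lambda>n. D (X n)) \<longlonglongrightarrow> D x"
    unfolding D_def by (intro tendsto_intros x)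
  moreover have "(\<lambda>n. m + inverse (real (Suc n))) \<longlonglongrightarrow> m + 0"
    by (intro tendsto_intros LIMSEQ_inverse_real_of_nat)
  ultimately have "D x \<le> m"
    using LIMSEQ_le[of "\<lambda>n. D (X n)" "D x" "\<lambda>n. m + inverse (real (Suc n))" "m + 0"] X
    by (auto intro: less_imp_le)
  have "(z - x) \<bullet> y = 0" if "y \<in> R" for y
  proof (rule ccontr)
    define d where "d = (z - x) \<bullet> y"
    assume "(z - x) \<bullet> y \<noteq> 0"
    then have "d \<noteq> 0" and pos: "0 < y \<bullet> y" by (auto simp: d_def)
    \<comment> \<open>the minimizer of the distance on the line through \<open>x\<close> in direction \<open>y\<close>\<close>
    define t where "t = d / (y \<bullet> y)"
    have th: "t * (y \<bullet> y) = d" using pos by (simp add: t_def)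
    have "D (x + t *\<^sub>R y) = D x - 2 * t * d + t * (t * (y \<bullet> y))"
      by (simp add: D_def d_def power2_norm_eq_inner inner_simps inner_commute algebra_simps)
    also have "\<dots> = D x - d\<^sup>2 / (y \<bullet> y)" by (simp add: th) (simp add: t_def power2_eq_square)
    also have "\<dots> < D x" using \<open>d \<noteq> 0\<close> pos by simp
    finally have "D (x + t *\<^sub>R y) < m" using \<open>D x \<le> m\<close> by simp
    moreover have "x + t *\<^sub>R y \<in> R"
      by (intro subspace_add[OF sub] subspace_scale[OF sub] \<open>x \<in> R\<close> that)
    ultimately show False using m_le by force
  qed
  with \<open>x \<in> R\<close> show ?thesis by blast
qed

section \<open>Totally real sets and their conjugations\<close>

definition totally_real :: "'a::complex_inner set \<Rightarrow> bool"
  where "totally_real R \<longleftrightarrow> (\<forall>x\<in>R. \<forall>y\<in>R. Im (cinner x y) = 0)"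

text \<open>The set \<open>R\<close> is its own orthogonal complement with respect to the symplectic form
  \<open>Im (cinner x y)\<close>.\<close>

definition lagrangian :: "'a::complex_inner set \<Rightarrow> bool"
  where "lagrangian R \<longleftrightarrow> R = {z. \<forall>x\<in>R. Im (cinner z x) = 0}"

text \<open>A maximal totally real set is Lagrangian: the form is alternating, so a vector that is
  orthogonal to the set can be adjoined to it.\<close>

lemma totally_real_extend_lagrangian:
  fixes S :: "'a::complex_inner set"
  assumes "totally_real S"
  shows "\<exists>R. S \<subseteq> R \<and> lagrangian R"
proof -
  define F where "F = {R. S \<subseteq> R \<and> totally_real R}"
  have "\<exists>R\<in>F. \<forall>X\<in>F. R \<subseteq> X \<longrightarrow> X = R"
  proof (rule subset_Zorn_nonempty)
    show "F \<noteq> {}" using assms by (auto simp: F_def)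
  next
    fix K assume "K \<noteq> {}" and chain: "subset.chain F K"
    then have KF: "K \<subseteq> F" and comp: "\<And>X Y. X \<in> K \<Longrightarrow> Y \<in> K \<Longrightarrow> X \<subseteq> Y \<or> Y \<subseteq> X"
      by (auto simp: subset_chain_def)
    have "Im (cinner x y) = 0" if "x \<in> X" "X \<in> K" "y \<in> Y" "Y \<in> K" for x y X Y
      using comp[OF that(2,4)] that KF unfolding F_def totally_real_def by blast
    then have "totally_real (\<Union>K)" by (auto simp: totally_real_def)
    moreover have "S \<subseteq> \<Union>K" using \<open>K \<noteq> {}\<close> KF by (auto simp: F_def)
    ultimately show "\<Union>K \<in> F" by (simp add: F_def)
  qed
  then obtain R where R: "S \<subseteq> R" "totally_real R"
    and max: "\<And>X. S \<subseteq> X \<Longrightarrow> totally_real X \<Longrightarrow> R \<subseteq> X \<Longrightarrow> X = R"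
    by (auto simp: F_def)
  have "z \<in> R" if "\<forall>x\<in>R. Im (cinner z x) = 0" for z
  proof -
    have "totally_real (insert z R)"
      using R(2) that by (auto simp: totally_real_def cinner_self Im_cinner_commute[of _ z])
    then have "insert z R = R" using R(1) by (intro max) auto
    then show ?thesis by blast
  qed
  moreover have "\<forall>x\<in>R. Im (cinner z x) = 0" if "z \<in> R" for z
    using R(2) that by (simp add: totally_real_def)
  ultimately have "lagrangian R" unfolding lagrangian_def by blast
  with R(1) show ?thesis by blast
qed

text \<open>In terms of the real inner product, a Lagrangian set is the orthogonal complement of its
  rotation by \<open>\<i>\<close>.\<close>

lemma lagrangian_closed_subspace:
  fixes R :: "'a::complex_inner set"
  assumes "lagrangian R"
  shows "subspace R" and "closed R"
proof -
  have eq: "R = {z. \<forall>x\<in>R. z \<bullet> (\<i> *\<^sub>C x) = 0}"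
    using assms by (simp add: lagrangian_def inner_scaleC_ii_right)
  show "subspace R"
    by (subst eq) (auto simp: subspace_def inner_simps)
  have "R = (\<Inter>x\<in>R. {z. z \<bullet> (\<i> *\<^sub>C x) = 0})" by (subst eq) auto
  moreover have "closed (\<Inter>x\<in>R. {z. z \<bullet> (\<i> *\<^sub>C x) = 0})"
    by (intro closed_INT ballI closed_Collect_eq continuous_intros)
  ultimately show "closed R" by simp
qed

text \<open>The residual of the orthogonal projection onto a Lagrangian \<open>R\<close> is orthogonal to \<open>R\<close>;
  multiplying it by \<open>-\<i>\<close> turns this into orthogonality to \<open>\<i> R\<close>, which is membership in \<open>R\<close>.\<close>

lemma lagrangian_decomposition:
  fixes R :: "'a::complex_hilbert set"
  assumes R: "lagrangian R"
  shows "\<exists>x\<in>R. \<exists>y\<in>R. z = x + \<i> *\<^sub>C y"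
proof -
  obtain x where "x \<in> R" and orth: "\<And>w. w \<in> R \<Longrightarrow> (z - x) \<bullet> w = 0"
    using closed_subspace_nearest_point[OF lagrangian_closed_subspace[OF R]] by blast
  define y where "y = - (\<i> *\<^sub>C (z - x))"
  have "Im (cinner y w) = 0" if "w \<in> R" for w
    using orth[OF that] by (simp add: y_def cinner_minus_left cinner_scaleC_left inner_eq_Re_cinner)
  then have "y \<in> R" using R unfolding lagrangian_def by blast
  moreover have "z = x + \<i> *\<^sub>C y"
    by (simp add: y_def scaleC_minus_right scaleC_ii_ii)
  ultimately show ?thesis using \<open>x \<in> R\<close> by blast
qed

lemma lagrangian_decomposition_unique:
  fixes R :: "'a::complex_inner set"
  assumes R: "lagrangian R" and mem: "x \<in> R" "y \<in> R" "u \<in> R" "v \<in> R"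
    and eq: "x + \<i> *\<^sub>C y = u + \<i> *\<^sub>C v"
  shows "x = u \<and> y = v"
proof -
  note sub = lagrangian_closed_subspace(1)[OF R]
  have diff: "x - u = \<i> *\<^sub>C (v - y)" using eq by (simp add: scaleC_diff_right algebra_simps)
  have "(x - u) \<bullet> (\<i> *\<^sub>C (v - y)) = 0"
    using R subspace_diff[OF sub mem(1,3)] subspace_diff[OF sub mem(4,2)]
    unfolding lagrangian_def inner_scaleC_ii_right by blast
  then have "x - u = 0" unfolding diff[symmetric] by simp
  moreover have "v - y = - (\<i> *\<^sub>C (x - u))" unfolding diff by (simp add: scaleC_ii_ii)
  moreover have "\<i> *\<^sub>C (0 :: 'a) = 0" using scaleC_diff_right[of \<i> "0::'a" 0] by simp
  ultimately show ?thesis by simp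
qed

text \<open>A Lagrangian subspace is a real form of the space, so it has a coordinatewise complex
  conjugation.\<close>

lemma lagrangian_conjugation:
  fixes R :: "'a::complex_hilbert set"
  assumes R: "lagrangian R"
  shows "\<exists>J. conjugation J \<and> (\<forall>x\<in>R. J x = x)"
proof -
  note sub = lagrangian_closed_subspace(1)[OF R]
  obtain a b where ab: "\<And>z. a z \<in> R" "\<And>z. b z \<in> R" "\<And>z. z = a z + \<i> *\<^sub>C b z"
    using lagrangian_decomposition[OF R] by metis
  define J where "J z = a z - \<i> *\<^sub>C b z" for z
  have J: "J z = x - \<i> *\<^sub>C y" if "z = x + \<i> *\<^sub>C y" "x \<in> R" "y \<in> R" for x y z
    using lagrangian_decomposition_unique[OF R ab(1,2)[of z] that(2,3)
        trans[OF ab(3)[symmetric] that(1)]]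
    by (simp add: J_def)
  have "J (z + w) = J z + J w" for z w
  proof -
    have "(a z + \<i> *\<^sub>C b z) + (a w + \<i> *\<^sub>C b w) = (a z + a w) + \<i> *\<^sub>C (b z + b w)"
      by (simp add: scaleC_add_right algebra_simps)
    then have "J (z + w) = (a z + a w) - \<i> *\<^sub>C (b z + b w)"
      by (intro J subspace_add[OF sub] ab) (simp flip: ab(3))
    then show ?thesis by (simp add: J_def scaleC_add_right)
  qed
  moreover have "J (c *\<^sub>C z) = cnj c *\<^sub>C J z" for c z
  proof -
    have cnj_split: "cnj c *\<^sub>C w = Re c *\<^sub>R w - Im c *\<^sub>R (\<i> *\<^sub>C w)" for w :: 'a
      by (simp add: scaleC_conv_scaleR[of "cnj c"])
    have comm: "\<i> *\<^sub>C (r *\<^sub>R w) = r *\<^sub>R (\<i> *\<^sub>C w)" for r and w :: 'a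
      by (simp add: scaleR_scaleC scaleC_scaleC mult.commute)
    have "J (c *\<^sub>C z) = (Re c *\<^sub>R a z - Im c *\<^sub>R b z) - \<i> *\<^sub>C (Re c *\<^sub>R b z + Im c *\<^sub>R a z)"
    proof (intro J subspace_add[OF sub] subspace_diff[OF sub] subspace_scale[OF sub] ab)
      show "c *\<^sub>C z = (Re c *\<^sub>R a z - Im c *\<^sub>R b z) + \<i> *\<^sub>C (Re c *\<^sub>R b z + Im c *\<^sub>R a z)"
        by (subst ab(3)[of z])
          (simp add: scaleC_conv_scaleR[of c] scaleC_add_right comm scaleC_ii_ii algebra_simps)
    qed
    also have "\<dots> = cnj c *\<^sub>C J z"
      by (simp add: J_def cnj_split scaleC_add_right scaleC_diff_right comm scaleC_ii_ii algebra_simps)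
    finally show ?thesis .
  qed
  moreover have "J (J z) = z" for z
  proof -
    have "J (J z) = a z - \<i> *\<^sub>C (- b z)"
      by (intro J subspace_neg[OF sub] ab) (simp add: J_def scaleC_minus_right)
    also have "\<dots> = a z + \<i> *\<^sub>C b z" by (simp add: scaleC_minus_right)
    finally show ?thesis by (simp flip: ab(3))
  qed
  moreover have "cinner (J z) (J w) = cinner w z" for z w
  proof -
    have sym: "cinner x y = cinner y x" if "x \<in> R" "y \<in> R" for x y
    proof -
      have "Im (cinner y x) = 0" using R that unfolding lagrangian_def by blast
      then show ?thesis by (subst cinner_commute) (simp add: complex_eq_iff)
    qed
    have "cinner (J z) (J w) = cinner (a w + \<i> *\<^sub>C b w) (a z + \<i> *\<^sub>C b z)"
      by (simp add: J_def cinner_simps algebra_simps sym[OF ab(1)[of z] ab(1)[of w]]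
          sym[OF ab(1)[of z] ab(2)[of w]] sym[OF ab(2)[of z] ab(1)[of w]]
          sym[OF ab(2)[of z] ab(2)[of w]])
    then show ?thesis by (simp flip: ab(3))
  qed
  moreover have "J x = x" if "x \<in> R" for x
  proof -
    have i0: "\<i> *\<^sub>C (0 :: 'a) = 0" using scaleC_diff_right[of \<i> "0::'a" 0] by simp
    show ?thesis using J[of x x 0] that subspace_0[OF sub] by (simp add: i0)
  qed
  ultimately have "conjugation J" "\<forall>x\<in>R. J x = x"
    by (simp_all add: conjugation_def fun_eq_iff)
  then show ?thesis by blast
qed

lemma totally_real_fixed_by_conjugation:
  fixes S :: "'a::complex_hilbert set"
  assumes "totally_real S"
  shows "\<exists>J. conjugation J \<and> (\<forall>x\<in>S. J x = x)"
proof -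
  obtain R where "S \<subseteq> R" "lagrangian R"
    using totally_real_extend_lagrangian[OF assms] by blast
  then show ?thesis using lagrangian_conjugation[of R] by blast
qed

section \<open>Products of conjugations\<close>

lemma conjugation_bounded_linear:
  fixes C :: "'a::complex_inner \<Rightarrow> 'a"
  assumes "conjugation C"
  shows "bounded_linear C"
proof -
  have add: "C (x + y) = C x + C y" and scale: "C (c *\<^sub>C x) = cnj c *\<^sub>C C x"
    and inner: "cinner (C x) (C y) = cinner y x" for c x y
    using assms unfolding conjugation_def by blast+
  have norm: "norm (C x) = norm x" for x
    using inner[of x x] by (simp add: norm_eq_sqrt_inner inner_eq_Re_cinner)
  show ?thesis
    by (rule bounded_linear_intro[where K = 1]) (simp_all add: add scale norm scaleR_scaleC)
qed

lemma cadjoint_comp_conjugations: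
  assumes C: "conjugation C" and J: "conjugation J"
  shows "cadjoint (C \<circ> J) = J \<circ> C"
proof (rule cadjoint_unique)
  fix x y
  have CC: "C (C y) = y" and JJ: "J (J x) = x"
    using C J by (auto simp: conjugation_def fun_eq_iff)
  have "cinner (C (J x)) (C (C y)) = cinner (C y) (J x)" using C by (simp add: conjugation_def)
  also have "\<dots> = cinner (J (J x)) (J (C y))" using J by (simp add: conjugation_def)
  finally show "cinner ((C \<circ> J) x) y = cinner x ((J \<circ> C) y)" by (simp add: CC JJ)
qed

lemma unitary_op_comp_conjugations:
  assumes C: "conjugation C" and J: "conjugation J"
  shows "unitary_op (C \<circ> J)"
proof -
  have "bounded_linear (C \<circ> J)"
    unfolding comp_def using C J
    by (intro bounded_linear_compose[of C J] conjugation_bounded_linear)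
  then have "bounded_clinear (C \<circ> J)"
    using C J by (simp add: bounded_clinear_def conjugation_def)
  then show ?thesis
    using C J
    by (auto simp: unitary_op_def cadjoint_comp_conjugations[OF C J] conjugation_def fun_eq_iff)
qed

lemma C_symmetric_comp_conjugations:
  assumes C: "conjugation C" and J: "conjugation J"
  shows "C_symmetric C (C \<circ> J)"
proof -
  have "C (C x) = x" for x using C by (auto simp: conjugation_def fun_eq_iff)
  then show ?thesis
    by (simp add: C_symmetric_def cadjoint_comp_conjugations[OF C J] fun_eq_iff)
qed

lemma C_symmetric_cadjoint:
  assumes C: "conjugation C" and "C_symmetric C T"
  shows "cadjoint T = C \<circ> T \<circ> C"
proof -
  have CC: "C (C x) = x" for x using C by (auto simp: conjugation_def fun_eq_iff)
  have T: "T x = C (cadjoint T (C x))" for x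
    using fun_cong[OF assms(2)[unfolded C_symmetric_def], of x] by simp
  show ?thesis by (simp add: fun_eq_iff T CC)
qed

section \<open>Partial isometries\<close>

text \<open>The range of \<open>T\<^sup>*\<close> lies in the orthogonal complement \<open>M\<close> of the kernel of \<open>T\<close>. Since \<open>T\<close>
  preserves inner products on \<open>M\<close>, for \<open>u\<close> in \<open>M\<close> the vector \<open>T\<^sup>* T u - u\<close> of \<open>M\<close> is orthogonal
  to \<open>M\<close>, so \<open>T\<^sup>* T\<close> is the identity on \<open>M\<close>.\<close>

lemma partial_isometry_cadjoint_comp:
  fixes T :: "'a::complex_hilbert \<Rightarrow> 'b::complex_inner"
  assumes "partial_isometry T"
  shows "cadjoint T (T (cadjoint T (T x))) = cadjoint T (T x)"
    and "T (cadjoint T (T x)) = T x"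
proof -
  define M where "M = orth_complement {y. T y = 0}"
  have T: "bounded_clinear T" and iso: "\<And>x. x \<in> M \<Longrightarrow> norm (T x) = norm x"
    using assms by (auto simp: partial_isometry_def M_def)
  note adj = cinner_cadjoint[OF T]
  have adj': "cinner (cadjoint T y) x = cinner y (T x)" for x y
    using arg_cong[OF adj[of x y], of cnj] by (simp flip: cinner_commute)
  have ran: "cadjoint T y \<in> M" for y
    using cinner_diff_right[of y 0 0] by (simp add: M_def orth_complement_def adj')
  have M_add: "u + v \<in> M" if "u \<in> M" "v \<in> M" for u v
    using that by (simp add: M_def orth_complement_def cinner_add_left)
  have M_scale: "c *\<^sub>C u \<in> M" if "u \<in> M" for c u
    using that by (simp add: M_def orth_complement_def cinner_scaleC_left)
  have fix_M: "cadjoint T (T u) = u" if u: "u \<in> M" for u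
  proof -
    define w where "w = cadjoint T (T u) - u"
    have "w \<in> M"
      using M_add[OF ran[of "T u"] M_scale[OF u, of "-1"]] by (simp add: w_def scaleC_minus1)
    have "cinner w w = cinner (T u) (T w) - cinner u w"
      by (subst (1) w_def) (simp add: cinner_diff_left adj')
    also have "\<dots> = 0"
      using clinear_isometry_cinner[OF T M_add M_scale iso u \<open>w \<in> M\<close>] by simp
    finally show ?thesis by (simp add: cinner_eq_zero_iff w_def)
  qed
  show idem: "cadjoint T (T (cadjoint T (T x))) = cadjoint T (T x)"
    by (rule fix_M[OF ran])
  \<comment> \<open>\<open>T\<^sup>* T\<close> and \<open>T\<close> have the same kernel, and \<open>T\<^sup>* T\<close> annihilates \<open>T\<^sup>* T x - x\<close>\<close>
  have diff: "T (u - v) = T u - T v" for u v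
    using T by (simp add: bounded_clinear_def linear_simps)
  define w where "w = cadjoint T (T x) - x"
  have "cinner (T w) (T w) = cinner (T (cadjoint T (T x))) (T w) - cinner (T x) (T w)"
    by (simp add: w_def diff cinner_diff_left)
  also have "\<dots> = 0"
    by (simp flip: adj' add: idem)
  finally have "T w = 0" by (simp add: cinner_eq_zero_iff)
  then show "T (cadjoint T (T x)) = T x" by (simp add: w_def diff)
qed

section \<open>The factorization\<close>

text \<open>The fixed vectors of \<open>C T\<close> form a totally real set because \<open>C T\<close> is, like a conjugation,
  isometric up to swapping the arguments on the range of \<open>T\<^sup>* T = (C T)\<^sup>2\<close>. A conjugation \<open>J\<close> fixing
  them agrees with \<open>C T\<close> on that range, since a vector \<open>x\<close> there is half of \<open>u + \<i> v\<close> for the fixed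
  vectors \<open>u = x + C T x\<close> and \<open>v = -\<i> (x - C T x)\<close>.\<close>

lemma conjugation_extending_C_symmetric:
  fixes C T :: "'h::complex_hilbert \<Rightarrow> 'h"
  assumes C: "conjugation C" and T: "bounded_clinear T" and sym: "C_symmetric C T"
  shows "\<exists>J. conjugation J \<and> (\<forall>x. cadjoint T (T x) = x \<longrightarrow> J x = C (T x))"
proof -
  have C_add: "C (x + y) = C x + C y" and C_scale: "C (c *\<^sub>C x) = cnj c *\<^sub>C C x"
    and C_inner: "cinner (C x) (C y) = cinner y x" for c x y
    using C by (auto simp: conjugation_def)
  have T_add: "T (x + y) = T x + T y" and T_diff: "T (x - y) = T x - T y"
    and T_scale: "T (c *\<^sub>C x) = c *\<^sub>C T x" for c x y
    using T by (auto simp: bounded_clinear_def linear_simps)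
  have C_diff: "C (x - y) = C x - C y" for x y
    using conjugation_bounded_linear[OF C] by (simp add: linear_simps)
  have adj: "cadjoint T (T x) = C (T (C (T x)))" for x
    using fun_cong[OF C_symmetric_cadjoint[OF C sym], of "T x"] by simp
  have "cinner x y = cinner y x" if "C (T x) = x" "C (T y) = y" for x y
  proof -
    have "cinner x y = cinner (T y) (T x)" using C_inner[of "T x" "T y"] that by simp
    also have "\<dots> = cinner y (cadjoint T (T x))" by (rule cinner_cadjoint[OF T])
    finally show ?thesis by (simp add: adj that)
  qed
  then have "Im (cinner x y) = 0" if "C (T x) = x" "C (T y) = y" for x y
    using Im_cinner_commute[of x y] that by simp
  then have "totally_real {x. C (T x) = x}"
    by (simp add: totally_real_def)
  then obtain J where J: "conjugation J" and fix_J: "\<And>x. C (T x) = x \<Longrightarrow> J x = x"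
    using totally_real_fixed_by_conjugation by blast
  have "J x = C (T x)" if x: "cadjoint T (T x) = x" for x
  proof -
    define u where "u = x + C (T x)"
    define v where "v = (- \<i>) *\<^sub>C (x - C (T x))"
    have "J u = u"
      using x by (intro fix_J) (simp add: u_def adj T_add C_add add.commute)
    moreover have "J v = v"
      using x by (intro fix_J)
        (simp add: v_def adj T_scale C_scale T_diff C_diff scaleC_diff_right scaleC_minus_left)
    moreover have iv: "\<i> *\<^sub>C v = x - C (T x)"
      by (simp add: v_def scaleC_scaleC scaleC_one)
    moreover have "x = (1/2) *\<^sub>R (u + \<i> *\<^sub>C v)"
      by (simp add: iv u_def flip: scaleR_2)
    ultimately have "J x = (1/2) *\<^sub>R (u - \<i> *\<^sub>C v)"
      using J by (simp add: conjugation_def scaleR_scaleC scaleC_minus_left)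
    then show ?thesis by (simp add: iv u_def flip: scaleR_2)
  qed
  with J show ?thesis by blast
qed

lemma cadjoint_comp_orthogonal_projection:
  fixes C T :: "'h::complex_hilbert \<Rightarrow> 'h"
  assumes C: "conjugation C" and sym: "C_symmetric C T" and iso: "partial_isometry T"
  shows "orthogonal_projection (cadjoint T \<circ> T)"
proof -
  have T: "bounded_clinear T" using iso by (simp add: partial_isometry_def)
  \<comment> \<open>boundedness of the adjoint can be read off from \<open>T\<^sup>* = C T C\<close>\<close>
  have eq: "cadjoint T \<circ> T = (\<lambda>x. C (T (C (T x))))"
    by (simp add: C_symmetric_cadjoint[OF C sym] fun_eq_iff)
  have bT: "bounded_linear T" and T_scale: "T (c *\<^sub>C x) = c *\<^sub>C T x" for c x
    using T by (auto simp: bounded_clinear_def)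
  have bC: "bounded_linear C" and C_scale: "C (c *\<^sub>C x) = cnj c *\<^sub>C C x" for c x
    using C by (auto simp: conjugation_def intro: conjugation_bounded_linear[OF C])
  have bCT: "bounded_linear (\<lambda>x. C (T x))"
    by (rule bounded_linear_compose[OF bC bT])
  have "bounded_clinear (cadjoint T \<circ> T)"
    unfolding bounded_clinear_def eq
    using bounded_linear_compose[OF bCT bCT] by (simp add: T_scale C_scale)
  moreover have "cadjoint (cadjoint T \<circ> T) = cadjoint T \<circ> T"
  proof (rule cadjoint_unique)
    fix x y
    have "cinner (cadjoint T (T x)) y = cnj (cinner y (cadjoint T (T x)))" by (rule cinner_commute)
    also have "\<dots> = cnj (cinner (T y) (T x))" by (simp only: cinner_cadjoint[OF T])
    also have "\<dots> = cinner (T x) (T y)" by (rule cinner_commute[symmetric])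
    also have "\<dots> = cinner x (cadjoint T (T y))" by (rule cinner_cadjoint[OF T])
    finally show "cinner ((cadjoint T \<circ> T) x) y = cinner x ((cadjoint T \<circ> T) y)" by simp
  qed
  ultimately show ?thesis
    by (simp add: orthogonal_projection_def fun_eq_iff partial_isometry_cadjoint_comp(1)[OF iso])
qed

theorem theorem3:
  fixes C T :: "'h::complex_hilbert \<Rightarrow> 'h"
  assumes "separable_space (euclidean :: 'h topology)"
    and "conjugation C"
    and "bounded_clinear T"
    and "C_symmetric C T"
    and "partial_isometry T"
  shows "\<exists>U P :: 'h \<Rightarrow> 'h. bounded_clinear U \<and> unitary_op U \<and> C_symmetric C U
    \<and> bounded_clinear P \<and> orthogonal_projection P \<and> T = U \<circ> P"
proof -
  obtain J where J: "conjugation J"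
    and J_eq: "\<And>x. cadjoint T (T x) = x \<Longrightarrow> J x = C (T x)"
    using conjugation_extending_C_symmetric[OF assms(2-4)] by blast
  define P where "P = cadjoint T \<circ> T"
  have P: "orthogonal_projection P"
    unfolding P_def by (rule cadjoint_comp_orthogonal_projection[OF assms(2,4,5)])
  have U: "unitary_op (C \<circ> J)" "C_symmetric C (C \<circ> J)"
    using unitary_op_comp_conjugations C_symmetric_comp_conjugations assms(2) J by auto
  have "T x = (C \<circ> J) (P x)" for x
  proof -
    have "J (P x) = C (T x)"
      unfolding P_def using partial_isometry_cadjoint_comp[OF assms(5), of x] J_eq by simp
    then show ?thesis using assms(2) by (simp add: conjugation_def fun_eq_iff)
  qed
  then have "T = (C \<circ> J) \<circ> P" by (simp add: fun_eq_iff)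
  with U P show ?thesis unfolding unitary_op_def orthogonal_projection_def by blast
qed

end
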